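(* Let $R$ be a simple right Goldie ring with the $2$-nil-sum property. Then $R$ is a field.
   Context: All rings are associative with identity. A central unit of $R$ is a unit of $R$ lying in the center of $R$; a non central-unit is an element that is not a central unit. A ring $R$ has the $2$-nil-sum property if every non central-unit of $R$ is a sum of two nilpotent elements of $R$. *)

theory Defs
  imports Main
begin

definition central :: "'a::ring_1 \<Rightarrow> bool" where
  "central x \<longleftrightarrow> (\<forall>y. x * y = y * x)"

definition is_unit :: "'a::ring_1 \<Rightarrow> bool" where
  "is_unit x \<longleftrightarrow> (\<exists>y. x * y = 1 \<and> y * x = 1)"

definition central_unit :: "'a::ring_1 \<Rightarrow> bool" where
  "central_unit x \<longleftrightarrow> is_unit x \<and> central x"

definition nilpotent :: "'a::ring_1 \<Rightarrow> bool" where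
  "nilpotent x \<longleftrightarrow> (\<exists>n. x ^ n = 0)"

definition two_nil_sum :: "'a::ring_1 itself \<Rightarrow> bool" where
  "two_nil_sum _ \<longleftrightarrow>
     (\<forall>x::'a. \<not> central_unit x \<longrightarrow> (\<exists>a b. nilpotent a \<and> nilpotent b \<and> x = a + b))"

definition additive_subgroup :: "'a::ring_1 set \<Rightarrow> bool" where
  "additive_subgroup I \<longleftrightarrow> 0 \<in> I \<and> (\<forall>x\<in>I. \<forall>y\<in>I. x + y \<in> I) \<and> (\<forall>x\<in>I. - x \<in> I)"

definition right_ideal :: "'a::ring_1 set \<Rightarrow> bool" where
  "right_ideal I \<longleftrightarrow> additive_subgroup I \<and> (\<forall>x\<in>I. \<forall>r. x * r \<in> I)"

definition two_sided_ideal :: "'a::ring_1 set \<Rightarrow> bool" where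
  "two_sided_ideal I \<longleftrightarrow> additive_subgroup I \<and> (\<forall>x\<in>I. \<forall>r. x * r \<in> I \<and> r * x \<in> I)"

definition simple_ring :: "'a::ring_1 itself \<Rightarrow> bool" where
  "simple_ring _ \<longleftrightarrow> (0::'a) \<noteq> 1 \<and>
     (\<forall>I::'a set. two_sided_ideal I \<longrightarrow> I = {0} \<or> I = UNIV)"

definition right_annihilator :: "'a::ring_1 set \<Rightarrow> 'a set" where
  "right_annihilator S = {x. \<forall>s\<in>S. s * x = 0}"

definition acc_right_annihilators :: "'a::ring_1 itself \<Rightarrow> bool" where
  "acc_right_annihilators _ \<longleftrightarrow>
     \<not> (\<exists>S :: nat \<Rightarrow> 'a set. \<forall>n. right_annihilator (S n) \<subset> right_annihilator (S (Suc n)))"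

definition independent_right_ideals :: "(nat \<Rightarrow> 'a::ring_1 set) \<Rightarrow> bool" where
  "independent_right_ideals I \<longleftrightarrow>
     (\<forall>n (x :: nat \<Rightarrow> 'a). (\<forall>i\<le>n. x i \<in> I i) \<longrightarrow> (\<Sum>i\<le>n. x i) = 0 \<longrightarrow> (\<forall>i\<le>n. x i = 0))"

definition finite_right_uniform_dim :: "'a::ring_1 itself \<Rightarrow> bool" where
  "finite_right_uniform_dim _ \<longleftrightarrow>
     \<not> (\<exists>I :: nat \<Rightarrow> 'a set. (\<forall>n. right_ideal (I n) \<and> I n \<noteq> {0}) \<and> independent_right_ideals I)"

definition right_goldie :: "'a::ring_1 itself \<Rightarrow> bool" where
  "right_goldie T \<longleftrightarrow> acc_right_annihilators T \<and> finite_right_uniform_dim T"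

definition is_field :: "'a::ring_1 itself \<Rightarrow> bool" where
  "is_field _ \<longleftrightarrow> (0::'a) \<noteq> 1 \<and> (\<forall>x y::'a. x * y = y * x) \<and>
     (\<forall>x::'a. x \<noteq> 0 \<longrightarrow> is_unit x)"

end

theory Submission
  imports Defs
begin

text \<open>
  Say that \<open>x\<close> has a domain corner if \<open>x r x s x = 0\<close> forces \<open>x r x = 0\<close> or \<open>x s x = 0\<close>; over a
  simple Artinian ring these are the elements of rank at most one. If such an \<open>x\<close> is a sum
  \<open>a + b\<close> of nilpotents, then \<open>x\<^sup>2 = 0\<close>: with a central indeterminate \<open>t\<close>, the polynomials
  \<open>P = (1 + t a)\<^sup>-\<^sup>1\<close> and \<open>Q = (1 - t b)\<^sup>-\<^sup>1\<close> satisfy \<open>Q = P + t P x Q\<close>, hence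
  \<open>x Q x = x P x + t x P x Q x\<close>, and by degrees one of \<open>x P x\<close>, \<open>x Q x\<close> vanishes.
  A nonzero \<open>x\<close> whose right annihilator is maximal has the property, and so does \<open>x r\<close> if
  \<open>x r x \<noteq> 0\<close>. As \<open>R\<close> is simple, such an \<open>r\<close> exists; then \<open>(x r)\<^sup>2 \<noteq> 0\<close>, so \<open>x r\<close> must be a
  central unit, \<open>R\<close> is a domain, \<open>0\<close> is its only nilpotent element, and all other elements are central units.
\<close>

definition domain_corner :: "'a::ring_1 \<Rightarrow> bool" where
  "domain_corner x \<longleftrightarrow> (\<forall>r s. x * r * x * s * x = 0 \<longrightarrow> x * r * x = 0 \<or> x * s * x = 0)"

lemma power_diff_noncomm:
  fixes b c :: "'a::ring_1"
  shows "b ^ n - c ^ n = (\<Sum>k<n. c ^ k * (b - c) * b ^ (n - 1 - k))"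
proof (induction n)
  case (Suc n)
  have "(\<Sum>k<n. c ^ k * (b - c) * b ^ (n - k)) = (\<Sum>k<n. c ^ k * (b - c) * b ^ (n - 1 - k)) * b"
    unfolding sum_distrib_right
  proof (rule sum.cong)
    fix k assume "k \<in> {..<n}"
    then have "n - k = Suc (n - 1 - k)" by auto
    then show "c ^ k * (b - c) * b ^ (n - k) = c ^ k * (b - c) * b ^ (n - 1 - k) * b"
      by (simp only: power_Suc2 mult.assoc)
  qed simp
  also have "\<dots> = (b ^ n - c ^ n) * b" using Suc by simp
  finally show ?case
    by (simp add: algebra_simps power_Suc2 del: power_Suc)
qed simp

lemma nilpotent_uminus: "nilpotent a \<Longrightarrow> nilpotent (- a)"
  unfolding nilpotent_def by (metis mult_zero_right power_minus)

text \<open>The index \<open>j\<close> is the degree of the polynomial with coefficients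
  \<open>x * b ^ m * x\<close>; its constant term \<open>x * x\<close> is nonzero, so a degree
  exists.\<close>

lemma nilpotent_last_power:
  assumes "nilpotent b" and "x * x \<noteq> 0"
  obtains j where "x * b ^ j * x \<noteq> 0" "\<And>m. j < m \<Longrightarrow> x * b ^ m * x = 0"
proof -
  obtain N where N: "b ^ N = 0" using assms(1) unfolding nilpotent_def by auto
  have "m \<le> N" if "x * b ^ m * x \<noteq> 0" for m
  proof (rule ccontr)
    assume "\<not> m \<le> N"
    then have "b ^ m = b ^ N * b ^ (m - N)" by (simp flip: power_add)
    with N that show False by simp
  qed
  moreover have "x * b ^ 0 * x \<noteq> 0" using assms(2) by simp
  ultimately obtain j where "x * b ^ j * x \<noteq> 0" "\<forall>m. x * b ^ m * x \<noteq> 0 \<longrightarrow> m \<le> j"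
    using Greatest_le_nat[of "\<lambda>m. x * b ^ m * x \<noteq> 0" _ N]
      GreatestI_nat[of "\<lambda>m. x * b ^ m * x \<noteq> 0" 0 N] by blast
  then show thesis using that by force
qed

lemma domain_corner_two_nil_sum:
  assumes "domain_corner x" and "nilpotent a" and "nilpotent b" and "x = a + b"
  shows "x * x = 0"
proof (rule ccontr)
  assume sq: "x * x \<noteq> 0"
  define c where "c = - a"
  have x: "x = b - c" using assms(4) by (simp add: c_def)
  obtain i where i: "x * c ^ i * x \<noteq> 0" "\<And>m. i < m \<Longrightarrow> x * c ^ m * x = 0"
    using nilpotent_last_power nilpotent_uminus[OF assms(2)] sq unfolding c_def by blast
  obtain j where j: "x * b ^ j * x \<noteq> 0" "\<And>m. j < m \<Longrightarrow> x * b ^ m * x = 0"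
    using nilpotent_last_power assms(3) sq by blast
  \<comment> \<open>This is the degree of \<open>t x P x Q x\<close>. It exceeds \<open>i\<close>
    and \<open>j\<close>, so both powers on the left of the identity contribute 0, and only
    \<open>k = i\<close> can survive on the right.\<close>
  define n where "n = Suc (i + j)"
  have term0: "x * c ^ k * x * b ^ (n - 1 - k) * x = 0" if "k \<noteq> i" for k
  proof (cases "i < k")
    case True
    then show ?thesis by (simp add: i(2))
  next
    case False
    then have "x * b ^ (n - 1 - k) * x = 0" using that by (intro j(2)) (simp add: n_def)
    then show ?thesis by (simp add: mult.assoc)
  qed
  have "0 = x * (b ^ n - c ^ n) * x"
    using i(2)[of n] j(2)[of n] by (simp add: n_def right_diff_distrib left_diff_distrib)
  also have "\<dots> = (\<Sum>k<n. x * c ^ k * x * b ^ (n - 1 - k) * x)"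
    unfolding power_diff_noncomm x[symmetric]
    by (simp add: sum_distrib_left sum_distrib_right mult.assoc)
  also have "\<dots> = (\<Sum>k\<in>{i}. x * c ^ k * x * b ^ (n - 1 - k) * x)"
  proof (rule sum.mono_neutral_right)
    show "\<forall>k\<in>{..<n} - {i}. x * c ^ k * x * b ^ (n - 1 - k) * x = 0" using term0 by blast
  qed (auto simp: n_def)
  also have "\<dots> = x * c ^ i * x * b ^ j * x" by (simp add: n_def)
  finally show False using assms(1) i(1) j(1) unfolding domain_corner_def by metis
qed

text \<open>Multiplying by one more \<open>x\<close> on the right gives a product to which the
  hypothesis on \<open>x\<close> applies; the factor \<open>x * r * x\<close>, being nonzero, is
  then cancelled.\<close>

lemma domain_corner_mult_right:
  assumes "domain_corner x" and "x * r * x \<noteq> 0"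
  shows "domain_corner (x * r)"
  unfolding domain_corner_def
proof (intro allI impI)
  fix t s
  assume "x * r * t * (x * r) * s * (x * r) = 0"
  then have "x * r * t * (x * r) * s * (x * r) * x = 0" by simp
  then have "x * (r * t) * x * (r * s * x * r) * x = 0" by (simp only: mult.assoc)
  then consider "x * (r * t) * x = 0" | "x * (r * s * x * r) * x = 0"
    using assms unfolding domain_corner_def by blast
  then show "x * r * t * (x * r) = 0 \<or> x * r * s * (x * r) = 0"
  proof cases
    case 1
    then have "x * (r * t) * x * r = 0" by simp
    then show ?thesis by (simp add: mult.assoc)
  next
    case 2
    then have "x * (r * s) * x * r * x = 0" by (simp only: mult.assoc)
    then have "x * (r * s) * x = 0"
      using assms unfolding domain_corner_def by blast
    then have "x * (r * s) * x * r = 0" by simp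
    then show ?thesis by (simp add: mult.assoc)
  qed
qed

lemma exists_domain_corner:
  assumes "acc_right_annihilators TYPE('a::ring_1)" and "(0::'a::ring_1) \<noteq> 1"
  obtains x :: "'a::ring_1" where "x \<noteq> 0" "domain_corner x"
proof -
  have "\<exists>x::'a. x \<noteq> 0 \<and> (\<forall>y. y \<noteq> 0 \<longrightarrow> \<not> right_annihilator {x} \<subset> right_annihilator {y})"
  proof (rule ccontr)
    assume "\<not> ?thesis"
    then obtain f :: "nat \<Rightarrow> 'a"
      where "\<forall>n. right_annihilator {f n} \<subset> right_annihilator {f (Suc n)}"
      using dependent_nat_choice[of "\<lambda>_ x. x \<noteq> 0"
          "\<lambda>_ x y. right_annihilator {x} \<subset> right_annihilator {y :: 'a}"] assms(2) by metis
    then show False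
      using assms(1) unfolding acc_right_annihilators_def
      by (auto dest!: spec[where x = "\<lambda>n. {f n}"])
  qed
  then obtain x :: 'a where x: "x \<noteq> 0"
    and max: "\<And>y. y \<noteq> 0 \<Longrightarrow> \<not> right_annihilator {x} \<subset> right_annihilator {y}" by blast
  have "domain_corner x"
    unfolding domain_corner_def
  proof (intro allI impI)
    fix r s
    assume eq: "x * r * x * s * x = 0"
    \<comment> \<open>By maximality this inclusion is an equality once \<open>x * r * x\<close> is
      nonzero.\<close>
    have "right_annihilator {x} \<subseteq> right_annihilator {x * r * x}"
      by (auto simp: right_annihilator_def mult.assoc)
    moreover have "s * x \<in> right_annihilator {x * r * x}"
      using eq by (simp add: right_annihilator_def mult.assoc)
    ultimately have "s * x \<in> right_annihilator {x}" if "x * r * x \<noteq> 0"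
      using max[OF that] by blast
    then show "x * r * x = 0 \<or> x * s * x = 0"
      by (auto simp: right_annihilator_def mult.assoc)
  qed
  with x that show thesis by blast
qed

text \<open>The elements killed on the left by all \<open>x * r\<close> form a two-sided ideal
  containing \<open>y\<close>; if it contains 1, then \<open>x = 0\<close>.\<close>

lemma simple_ring_prime:
  fixes x y :: "'a::ring_1"
  assumes "simple_ring TYPE('a)" and "\<And>r. x * r * y = 0"
  shows "x = 0 \<or> y = 0"
proof -
  define I where "I = {z. \<forall>r. x * r * z = 0}"
  have "x * r * (z * t) = 0" if "x * r * z = 0" for r z t
    using that by (metis mult.assoc mult_zero_left)
  moreover have "x * r * (t * z) = 0" if "\<forall>r. x * r * z = 0" for r z t
    using that by (metis mult.assoc)
  ultimately have "two_sided_ideal I"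
    unfolding two_sided_ideal_def additive_subgroup_def I_def by (auto simp: distrib_left)
  then have "I = {0} \<or> I = UNIV" using assms(1) unfolding simple_ring_def by blast
  then show ?thesis
  proof
    assume "I = {0}"
    then show ?thesis using assms(2) unfolding I_def by blast
  next
    assume "I = UNIV"
    then have "x * 1 * 1 = 0" unfolding I_def by blast
    then show ?thesis by simp
  qed
qed

lemma domain_if_central_unit_domain_corner:
  fixes y r s :: "'a::ring_1"
  assumes "central_unit y" and "domain_corner y" and "r * s = 0"
  shows "r = 0 \<or> s = 0"
proof -
  obtain z where z: "z * y = 1"
    using assms(1) unfolding central_unit_def is_unit_def by blast
  have comm: "y * t = t * y" for t
    using assms(1) unfolding central_unit_def central_def by blast
  have cancel: "t = 0" if "y * t * y = 0" for t
    using that z comm by (metis mult.assoc mult_1_left mult_zero_right)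
  have "y * r * y * s * y = y * y * (r * s) * y"
    by (metis comm mult.assoc)
  then have "y * r * y * s * y = 0" using assms(3) by simp
  then show ?thesis using assms(2) cancel unfolding domain_corner_def by blast
qed

theorem theorem3p8:
  assumes "simple_ring TYPE('a::ring_1)"
    and "right_goldie TYPE('a)"
    and "two_nil_sum TYPE('a)"
  shows "is_field TYPE('a)"
proof -
  have nontriv: "(0::'a) \<noteq> 1" using assms(1) unfolding simple_ring_def by blast
  obtain x :: 'a where x: "x \<noteq> 0" "domain_corner x"
    using exists_domain_corner assms(2) nontriv unfolding right_goldie_def by blast
  have "\<exists>r. x * r * x \<noteq> 0" using simple_ring_prime[OF assms(1)] x(1) by blast
  \<comment> \<open>The corner property is used with \<open>s = r\<close>.\<close>
  then obtain r where "x * r * x * r * x \<noteq> 0"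
    using x(2) unfolding domain_corner_def by blast
  then have sq: "x * r * (x * r) \<noteq> 0" by (metis mult.assoc mult_zero_left)
  then have "x * r * x \<noteq> 0" by (metis mult.assoc mult_zero_left)
  with x(2) have corner: "domain_corner (x * r)" by (rule domain_corner_mult_right)
  have "central_unit (x * r)"
    using assms(3) domain_corner_two_nil_sum[OF corner] sq unfolding two_nil_sum_def by blast
  note domain = domain_if_central_unit_domain_corner[OF this corner]
  have nil: "a = 0" if "nilpotent a" for a :: 'a
  proof -
    have "a ^ n = 0 \<Longrightarrow> a = 0" for n
      by (induction n) (use nontriv domain in auto)
    with that show ?thesis unfolding nilpotent_def by blast
  qed
  \<comment> \<open>Otherwise \<open>z\<close> would be a sum of two nilpotents, hence
    \<open>0 + 0\<close>.\<close>
  have unit: "central_unit z" if "z \<noteq> 0" for z :: 'a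
    using assms(3) nil that unfolding two_nil_sum_def by (metis add_0)
  show ?thesis
    unfolding is_field_def
    using nontriv unit unfolding central_unit_def central_def
    by metis
qed

end
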